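(* Let $(\mathbf{A},\Box,\Diamond)$ be a finite G\"odel algebra with operators (GAO). Then $(\mathbf{A},\Box,\Diamond)$ is isomorphic to the GAO $(\mathbf{G}(\mathbf{F}_{\mathbf{A}}),\beta,\delta)$ through the mapping $r:A\to G(\mathbf{F}_{\mathbf{A}})$ given, for every $a\in A$, by $r(a)=\{f\in F_{\mathbf{A}}\mid a\in f\}$. In particular, for all $a\in A$, $$r(\Box(a))=\beta(r(a))\quad\text{and}\quad r(\Diamond(a))=\delta(r(a)).$$
   Context: A G\"odel algebra is a Heyting algebra $\mathbf{A}=(A,\wedge,\vee,\to,\bot,\top)$ satisfying prelinearity $(a\to b)\vee(b\to a)=\top$. A G\"odel algebra with operators (GAO) is a triple $(\mathbf{A},\Box,\Diamond)$ with $\mathbf{A}$ a G\"odel algebra and $\Box,\Diamond:A\to A$ satisfying $\Box\top=\top$, $\Box(x\wedge y)=\Box x\wedge\Box y$, $\Diamond\bot=\bot$, $\Diamond(x\vee y)=\Diamond x\vee\Diamond y$. A forest is a finite poset in which the downset of each element is totally ordered. For a finite G\"odel algebra $\mathbf{A}$, $F_{\mathbf{A}}$ is the set of its prime (proper) filters, ordered by $f_1\leq f_2$ iff $f_1\supseteq f_2$; $\mathbf{F}_{\mathbf{A}}=(F_{\mathbf{A}},\leq)$ is a finite forest. For a finite forest $\mathbf{F}=(F,\leq)$, $G(\mathbf{F})$ is the set of all downward closed subsets of $F$, and $\mathbf{G}(\mathbf{F})=(G(\mathbf{F}),\cap,\cup,\to,\emptyset,F)$ with $x\to y=F\setminus{\uparrow}(x\setminus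 y)$, which is a G\"odel algebra. For a GAO $(\mathbf{A},\Box,\Diamond)$, define relations on $F_{\mathbf{A}}$: $f_1R_\Box f_2$ iff $\Box^{-1}(f_1)\subseteq f_2$; $f_1R_\Diamond f_2$ iff $f_2\subseteq\Diamond^{-1}(f_1)$ (equivalently $\Diamond(f_2)\subseteq f_1$). Then for $a\in G(\mathbf{F}_{\mathbf{A}})$: $\beta(a)=\{y\in F_{\mathbf{A}}\mid\forall z\in F_{\mathbf{A}},\ (yR_\Box z\Rightarrow z\in a)\}$ and $\delta(a)=\{y\in F_{\mathbf{A}}\mid\exists z\in a,\ yR_\Diamond z\}$. *)

theory Defs
  imports Main "HOL-Algebra.Congruence"
begin

text \<open>
  The dual algebra of a finite Goedel algebra lives on a set of sets of prime filters, which is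
  not a type of its own. All algebras are therefore records with an explicit carrier, and their
  axioms are relativised to it.
\<close>

record 'a heyting = "'a partial_object" +
  hmeet :: "'a \<Rightarrow> 'a \<Rightarrow> 'a" (infixl "\<sqinter>\<index>" 70)
  hjoin :: "'a \<Rightarrow> 'a \<Rightarrow> 'a" (infixl "\<squnion>\<index>" 65)
  himp :: "'a \<Rightarrow> 'a \<Rightarrow> 'a" (infixr "\<Rrightarrow>\<index>" 60)
  hbot :: 'a ("\<bottom>\<index>")
  htop :: 'a ("\<top>\<index>")

definition hle :: "('a, 'm) heyting_scheme \<Rightarrow> 'a \<Rightarrow> 'a \<Rightarrow> bool" (infix "\<sqsubseteq>\<index>" 50)
  where "x \<sqsubseteq>\<^bsub>A\<^esub> y \<longleftrightarrow> x \<sqinter>\<^bsub>A\<^esub> y = x"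

locale heyting_algebra =
  fixes A (structure)
  assumes meet_closed: "\<lbrakk>x \<in> carrier A; y \<in> carrier A\<rbrakk> \<Longrightarrow> x \<sqinter> y \<in> carrier A"
    and join_closed: "\<lbrakk>x \<in> carrier A; y \<in> carrier A\<rbrakk> \<Longrightarrow> x \<squnion> y \<in> carrier A"
    and imp_closed: "\<lbrakk>x \<in> carrier A; y \<in> carrier A\<rbrakk> \<Longrightarrow> (x \<Rrightarrow> y) \<in> carrier A"
    and bot_closed: "\<bottom> \<in> carrier A"
    and top_closed: "\<top> \<in> carrier A"
    and meet_assoc: "\<lbrakk>x \<in> carrier A; y \<in> carrier A; z \<in> carrier A\<rbrakk>
        \<Longrightarrow> (x \<sqinter> y) \<sqinter> z = x \<sqinter> (y \<sqinter> z)"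
    and meet_comm: "\<lbrakk>x \<in> carrier A; y \<in> carrier A\<rbrakk> \<Longrightarrow> x \<sqinter> y = y \<sqinter> x"
    and join_assoc: "\<lbrakk>x \<in> carrier A; y \<in> carrier A; z \<in> carrier A\<rbrakk>
        \<Longrightarrow> (x \<squnion> y) \<squnion> z = x \<squnion> (y \<squnion> z)"
    and join_comm: "\<lbrakk>x \<in> carrier A; y \<in> carrier A\<rbrakk> \<Longrightarrow> x \<squnion> y = y \<squnion> x"
    and meet_join_absorb: "\<lbrakk>x \<in> carrier A; y \<in> carrier A\<rbrakk> \<Longrightarrow> x \<sqinter> (x \<squnion> y) = x"
    and join_meet_absorb: "\<lbrakk>x \<in> carrier A; y \<in> carrier A\<rbrakk> \<Longrightarrow> x \<squnion> (x \<sqinter> y) = x"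
    and bot_least: "x \<in> carrier A \<Longrightarrow> \<bottom> \<sqsubseteq> x"
    and top_greatest: "x \<in> carrier A \<Longrightarrow> x \<sqsubseteq> \<top>"
    and residuation: "\<lbrakk>x \<in> carrier A; y \<in> carrier A; z \<in> carrier A\<rbrakk>
        \<Longrightarrow> x \<sqinter> y \<sqsubseteq> z \<longleftrightarrow> x \<sqsubseteq> (y \<Rrightarrow> z)"

locale godel_algebra = heyting_algebra +
  assumes prelinearity: "\<lbrakk>x \<in> carrier A; y \<in> carrier A\<rbrakk> \<Longrightarrow> (x \<Rrightarrow> y) \<squnion> (y \<Rrightarrow> x) = \<top>"

record 'a gao = "'a heyting" +
  box :: "'a \<Rightarrow> 'a"
  dia :: "'a \<Rightarrow> 'a"

locale godel_algebra_with_operators = godel_algebra A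
  for A :: "('a, 'm) gao_scheme" (structure) +
  assumes box_closed: "x \<in> carrier A \<Longrightarrow> box A x \<in> carrier A"
    and dia_closed: "x \<in> carrier A \<Longrightarrow> dia A x \<in> carrier A"
    and box_top: "box A \<top> = \<top>"
    and box_meet: "\<lbrakk>x \<in> carrier A; y \<in> carrier A\<rbrakk> \<Longrightarrow> box A (x \<sqinter> y) = box A x \<sqinter> box A y"
    and dia_bot: "dia A \<bottom> = \<bottom>"
    and dia_join: "\<lbrakk>x \<in> carrier A; y \<in> carrier A\<rbrakk> \<Longrightarrow> dia A (x \<squnion> y) = dia A x \<squnion> dia A y"

definition gao_iso ::
  "('a \<Rightarrow> 'b) \<Rightarrow> ('a, 'm) gao_scheme \<Rightarrow> ('b, 'n) gao_scheme \<Rightarrow> bool" where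
  "gao_iso h A B \<longleftrightarrow>
     bij_betw h (carrier A) (carrier B) \<and>
     (\<forall>x\<in>carrier A. \<forall>y\<in>carrier A. h (x \<sqinter>\<^bsub>A\<^esub> y) = h x \<sqinter>\<^bsub>B\<^esub> h y) \<and>
     (\<forall>x\<in>carrier A. \<forall>y\<in>carrier A. h (x \<squnion>\<^bsub>A\<^esub> y) = h x \<squnion>\<^bsub>B\<^esub> h y) \<and>
     (\<forall>x\<in>carrier A. \<forall>y\<in>carrier A. h (x \<Rrightarrow>\<^bsub>A\<^esub> y) = (h x \<Rrightarrow>\<^bsub>B\<^esub> h y)) \<and>
     h \<bottom>\<^bsub>A\<^esub> = \<bottom>\<^bsub>B\<^esub> \<and>
     h \<top>\<^bsub>A\<^esub> = \<top>\<^bsub>B\<^esub> \<and>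
     (\<forall>x\<in>carrier A. h (box A x) = box B (h x)) \<and>
     (\<forall>x\<in>carrier A. h (dia A x) = dia B (h x))"

definition lattice_filter :: "('a, 'm) heyting_scheme \<Rightarrow> 'a set \<Rightarrow> bool" where
  "lattice_filter A f \<longleftrightarrow>
     f \<subseteq> carrier A \<and> f \<noteq> {} \<and>
     (\<forall>x\<in>f. \<forall>y\<in>f. x \<sqinter>\<^bsub>A\<^esub> y \<in> f) \<and>
     (\<forall>x\<in>f. \<forall>y\<in>carrier A. x \<sqsubseteq>\<^bsub>A\<^esub> y \<longrightarrow> y \<in> f)"

definition prime_filters :: "('a, 'm) heyting_scheme \<Rightarrow> 'a set set" where
  "prime_filters A = {f. lattice_filter A f \<and> f \<noteq> carrier A \<and>
     (\<forall>x\<in>carrier A. \<forall>y\<in>carrier A. x \<squnion>\<^bsub>A\<^esub> y \<in> f \<longrightarrow> x \<in> f \<or> y \<in> f)}"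

text \<open>The order on prime filters is reverse inclusion.\<close>

definition prime_filter_order :: "('a, 'm) heyting_scheme \<Rightarrow> ('a set \<times> 'a set) set" where
  "prime_filter_order A =
     {(f1, f2). f1 \<in> prime_filters A \<and> f2 \<in> prime_filters A \<and> f1 \<supseteq> f2}"

definition finite_forest :: "'p set \<Rightarrow> ('p \<times> 'p) set \<Rightarrow> bool" where
  "finite_forest F r \<longleftrightarrow>
     finite F \<and> partial_order_on F r \<and> (\<forall>x\<in>F. total_on {y \<in> F. (y, x) \<in> r} r)"

text \<open>In the implication, the relational image under \<open>r\<close> is the upset generated by a set.\<close>

definition downset_algebra :: "'p set \<Rightarrow> ('p \<times> 'p) set \<Rightarrow> 'p set heyting" where
  "downset_algebra F r =
     \<lparr> carrier = {S. S \<subseteq> F \<and> (\<forall>x\<in>S. \<forall>y\<in>F. (y, x) \<in> r \<longrightarrow> y \<in> S)},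
       hmeet = (\<inter>), hjoin = (\<union>), himp = (\<lambda>S T. F - r `` (S - T)),
       hbot = {}, htop = F \<rparr>"

definition R_box :: "('a, 'm) gao_scheme \<Rightarrow> ('a set \<times> 'a set) set" where
  "R_box A = {(f1, f2). f1 \<in> prime_filters A \<and> f2 \<in> prime_filters A \<and>
     {x \<in> carrier A. box A x \<in> f1} \<subseteq> f2}"

definition R_dia :: "('a, 'm) gao_scheme \<Rightarrow> ('a set \<times> 'a set) set" where
  "R_dia A = {(f1, f2). f1 \<in> prime_filters A \<and> f2 \<in> prime_filters A \<and>
     f2 \<subseteq> {x \<in> carrier A. dia A x \<in> f1}}"

definition beta :: "('a, 'm) gao_scheme \<Rightarrow> 'a set set \<Rightarrow> 'a set set" where
  "beta A S = {y \<in> prime_filters A. \<forall>z\<in>prime_filters A. (y, z) \<in> R_box A \<longrightarrow> z \<in> S}"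

definition delta :: "('a, 'm) gao_scheme \<Rightarrow> 'a set set \<Rightarrow> 'a set set" where
  "delta A S = {y \<in> prime_filters A. \<exists>z\<in>S. (y, z) \<in> R_dia A}"

definition dual_gao :: "('a, 'm) gao_scheme \<Rightarrow> 'a set set gao" where
  "dual_gao A = heyting.extend
     (downset_algebra (prime_filters A) (prime_filter_order A))
     (gao.fields (beta A) (delta A))"

definition repr_map :: "('a, 'm) heyting_scheme \<Rightarrow> 'a \<Rightarrow> 'a set set" where
  "repr_map A a = {f \<in> prime_filters A. a \<in> f}"

lemma dual_gao_simps:
  "carrier (dual_gao A) = carrier (downset_algebra (prime_filters A) (prime_filter_order A))"
  "hmeet (dual_gao A) = (\<inter>)"
  "hjoin (dual_gao A) = (\<union>)"
  "himp (dual_gao A) = (\<lambda>S T. prime_filters A - prime_filter_order A `` (S - T))"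
  "hbot (dual_gao A) = {}"
  "htop (dual_gao A) = prime_filters A"
  "box (dual_gao A) = beta A"
  "dia (dual_gao A) = delta A"
  by (simp_all add: dual_gao_def downset_algebra_def heyting.defs gao.defs)

text \<open>The dual of a finite Goedel algebra is indeed a finite forest.\<close>

lemma (in godel_algebra) finite_forest_prime_filters:
  assumes fin: "finite (carrier A)"
  shows "finite_forest (prime_filters A) (prime_filter_order A)"
proof -
  have "prime_filters A \<subseteq> Pow (carrier A)"
    by (auto simp: prime_filters_def lattice_filter_def)
  then have "finite (prime_filters A)"
    using fin finite_subset by blast
  moreover have "partial_order_on (prime_filters A) (prime_filter_order A)"
    by (auto simp: partial_order_on_def preorder_on_def refl_on_def trans_def antisym_def
        prime_filter_order_def)
  moreover have "g1 \<subseteq> g2 \<or> g2 \<subseteq> g1"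
    if f: "f \<in> prime_filters A" and g1: "g1 \<in> prime_filters A" and g2: "g2 \<in> prime_filters A"
      and sub: "f \<subseteq> g1" "f \<subseteq> g2" for f g1 g2
  proof (rule ccontr)
    assume "\<not> ?thesis"
    then obtain a b where ab: "a \<in> g1" "a \<notin> g2" "b \<in> g2" "b \<notin> g1" by blast
    have car: "a \<in> carrier A" "b \<in> carrier A"
      using ab g1 g2 by (auto simp: prime_filters_def lattice_filter_def)
    have up: "y \<in> g" if "g \<in> prime_filters A" "x \<in> g" "x \<sqsubseteq> y" "y \<in> carrier A" for g x y
      using that unfolding prime_filters_def lattice_filter_def by blast
    have mp: "y \<in> g" if "g \<in> prime_filters A" "x \<in> g" "(x \<Rrightarrow> y) \<in> g"
      "x \<in> carrier A" "y \<in> carrier A" for g x y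
    proof -
      let ?i = "x \<Rrightarrow> y"
      have i: "?i \<in> carrier A" using that imp_closed by blast
      have "?i \<squnion> (?i \<sqinter> ?i) = ?i" using join_meet_absorb i by blast
      then have "?i \<sqinter> ?i = ?i" using meet_join_absorb[of ?i "?i \<sqinter> ?i"] i meet_closed by metis
      then have "?i \<sqinter> x \<sqsubseteq> y" using residuation[of ?i x y] i that by (simp add: hle_def)
      moreover have "?i \<sqinter> x \<in> g"
        using that unfolding prime_filters_def lattice_filter_def by blast
      ultimately show ?thesis
        using up that by blast
    qed
    obtain c where "c \<in> f" "c \<in> carrier A"
      using f unfolding prime_filters_def lattice_filter_def by blast
    then have "\<top> \<in> f"
      using up f top_greatest top_closed by blast
    then have "(a \<Rrightarrow> b) \<squnion> (b \<Rrightarrow> a) \<in> f" using prelinearity car by simp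
    then have "(a \<Rrightarrow> b) \<in> f \<or> (b \<Rrightarrow> a) \<in> f"
      using f imp_closed car by (simp add: prime_filters_def)
    then show False using mp ab g1 g2 sub car by blast
  qed
  ultimately show ?thesis
    by (auto simp: finite_forest_def total_on_def prime_filter_order_def)
qed

end

theory Submission
  imports Defs
begin

text \<open>
  This is Priestley duality for finite distributive lattices with a normal box and a normal diamond.
  Everything rests on the prime filter theorem, applied to suitable disjoint pairs of a filter and an
  ideal: the pair \<open>(\<up>a, \<down>b)\<close> separates points, the filter generated by \<open>f \<union> {x}\<close> and \<open>\<down>y\<close> give
  implication, \<open>\<box>\<^sup>-\<^sup>1(f)\<close> and \<open>\<down>a\<close> give the box, and \<open>\<up>a\<close> and the complement of \<open>\<diamond>\<^sup>-\<^sup>1(f)\<close>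
  give the diamond. Finiteness makes every filter principal, whence surjectivity. That the dual
  is a Goedel algebra with operators is then transported along the bijection.
\<close>

section \<open>Order, lattice laws and distributivity in a Heyting algebra\<close>

context heyting_algebra
begin

text \<open>Absorption twice: \<open>x\<close> equals \<open>x \<squnion> (x \<sqinter> x)\<close>,
  and meeting the latter with \<open>x\<close> gives back \<open>x\<close>.\<close>

lemma meet_idem: "x \<in> carrier A \<Longrightarrow> x \<sqinter> x = x"
  using join_meet_absorb meet_join_absorb meet_closed by metis

lemma le_refl: "x \<in> carrier A \<Longrightarrow> x \<sqsubseteq> x"
  by (simp add: hle_def meet_idem)

lemma le_trans:
  "\<lbrakk>x \<in> carrier A; y \<in> carrier A; z \<in> carrier A; x \<sqsubseteq> y; y \<sqsubseteq> z\<rbrakk> \<Longrightarrow> x \<sqsubseteq> z"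
  unfolding hle_def using meet_assoc by metis

lemma le_antisym: "\<lbrakk>x \<in> carrier A; y \<in> carrier A; x \<sqsubseteq> y; y \<sqsubseteq> x\<rbrakk> \<Longrightarrow> x = y"
  unfolding hle_def using meet_comm by metis

lemma meet_le1: "\<lbrakk>x \<in> carrier A; y \<in> carrier A\<rbrakk> \<Longrightarrow> x \<sqinter> y \<sqsubseteq> x"
  unfolding hle_def using meet_assoc meet_comm meet_idem by metis

lemma meet_le2: "\<lbrakk>x \<in> carrier A; y \<in> carrier A\<rbrakk> \<Longrightarrow> x \<sqinter> y \<sqsubseteq> y"
  using meet_le1 meet_comm by metis

lemma meet_greatest:
  "\<lbrakk>x \<in> carrier A; y \<in> carrier A; z \<in> carrier A; z \<sqsubseteq> x; z \<sqsubseteq> y\<rbrakk> \<Longrightarrow> z \<sqsubseteq> x \<sqinter> y"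
  unfolding hle_def using meet_assoc by metis

lemma meet_mono:
  assumes "x \<in> carrier A" "y \<in> carrier A" "x' \<in> carrier A" "y' \<in> carrier A"
    and "x \<sqsubseteq> x'" "y \<sqsubseteq> y'"
  shows "x \<sqinter> y \<sqsubseteq> x' \<sqinter> y'"
  using assms meet_greatest meet_closed le_trans meet_le1 meet_le2 by meson

lemma le_iff_join: "\<lbrakk>x \<in> carrier A; y \<in> carrier A\<rbrakk> \<Longrightarrow> x \<sqsubseteq> y \<longleftrightarrow> x \<squnion> y = y"
  unfolding hle_def using meet_join_absorb join_meet_absorb meet_comm join_comm by metis

lemma join_ge1: "\<lbrakk>x \<in> carrier A; y \<in> carrier A\<rbrakk> \<Longrightarrow> x \<sqsubseteq> x \<squnion> y"
  by (simp add: hle_def meet_join_absorb)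

lemma join_ge2: "\<lbrakk>x \<in> carrier A; y \<in> carrier A\<rbrakk> \<Longrightarrow> y \<sqsubseteq> x \<squnion> y"
  using join_ge1 join_comm by metis

lemma join_least:
  "\<lbrakk>x \<in> carrier A; y \<in> carrier A; z \<in> carrier A; x \<sqsubseteq> z; y \<sqsubseteq> z\<rbrakk> \<Longrightarrow> x \<squnion> y \<sqsubseteq> z"
  using le_iff_join join_assoc join_closed by metis

text \<open>Distributivity in the form that primeness of a maximal filter requires. By residuation
  both \<open>x\<close> and \<open>y\<close> lie below \<open>w \<Rrightarrow> j\<close>, hence so
  does their join.\<close>

lemma meet_join_le:
  assumes "w \<in> carrier A" "x \<in> carrier A" "y \<in> carrier A" "j \<in> carrier A"
    and "w \<sqinter> x \<sqsubseteq> j" "w \<sqinter> y \<sqsubseteq> j"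
  shows "w \<sqinter> (x \<squnion> y) \<sqsubseteq> j"
proof -
  have "x \<sqsubseteq> (w \<Rrightarrow> j)" "y \<sqsubseteq> (w \<Rrightarrow> j)"
    using assms residuation meet_comm by metis+
  then have "x \<squnion> y \<sqsubseteq> (w \<Rrightarrow> j)"
    using assms join_least imp_closed by blast
  then show ?thesis
    using assms residuation meet_comm join_closed by metis
qed

section \<open>Filters, principal filters and adjoining an element\<close>

lemma filter_carrier: "\<lbrakk>lattice_filter A f; x \<in> f\<rbrakk> \<Longrightarrow> x \<in> carrier A"
  by (auto simp: lattice_filter_def)

lemma filter_meet: "\<lbrakk>lattice_filter A f; x \<in> f; y \<in> f\<rbrakk> \<Longrightarrow> x \<sqinter> y \<in> f"
  by (auto simp: lattice_filter_def)

lemma filter_up: "\<lbrakk>lattice_filter A f; x \<in> f; x \<sqsubseteq> y; y \<in> carrier A\<rbrakk> \<Longrightarrow> y \<in> f"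
  unfolding lattice_filter_def by blast

lemma filter_top: "lattice_filter A f \<Longrightarrow> \<top> \<in> f"
  using filter_up filter_carrier top_greatest top_closed unfolding lattice_filter_def by blast

lemma prime_filter_bot: "f \<in> prime_filters A \<Longrightarrow> \<bottom> \<notin> f"
  using filter_up filter_carrier bot_least unfolding prime_filters_def by blast

lemma principal_filter:
  assumes a: "a \<in> carrier A"
  shows "lattice_filter A {x \<in> carrier A. a \<sqsubseteq> x}" (is "lattice_filter A ?g")
proof -
  have "a \<in> ?g" using a le_refl by blast
  moreover have "x \<sqinter> y \<in> ?g" if "x \<in> ?g" "y \<in> ?g" for x y
    using that a meet_greatest meet_closed by simp
  moreover have "y \<in> ?g" if "x \<in> ?g" "y \<in> carrier A" "x \<sqsubseteq> y" for x y
    using that a le_trans[of a x y] by simp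
  ultimately show ?thesis unfolding lattice_filter_def by blast
qed

text \<open>This set is the filter generated by \<open>f\<close> and \<open>x\<close>. If
  \<open>u\<close> witnesses membership of \<open>y\<close> and \<open>v\<close> that of
  \<open>z\<close>, then \<open>u \<sqinter> v\<close> witnesses that of
  \<open>y \<sqinter> z\<close>.\<close>

lemma filter_adjoin:
  assumes f: "lattice_filter A f" and x: "x \<in> carrier A"
  shows "lattice_filter A {z \<in> carrier A. \<exists>u\<in>f. u \<sqinter> x \<sqsubseteq> z}" (is "lattice_filter A ?g")
    and "f \<subseteq> {z \<in> carrier A. \<exists>u\<in>f. u \<sqinter> x \<sqsubseteq> z}"
    and "x \<in> {z \<in> carrier A. \<exists>u\<in>f. u \<sqinter> x \<sqsubseteq> z}"
proof -
  show "f \<subseteq> ?g" using filter_carrier[OF f] meet_le1 x by blast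
  show xg: "x \<in> ?g" using filter_carrier[OF f] filter_top[OF f] meet_le2 x by blast
  have "y \<sqinter> z \<in> ?g" if "y \<in> ?g" "z \<in> ?g" for y z
  proof -
    from that obtain u v where uv: "u \<in> f" "v \<in> f" "u \<sqinter> x \<sqsubseteq> y" "v \<sqinter> x \<sqsubseteq> z"
      and yz: "y \<in> carrier A" "z \<in> carrier A" by blast
    have car: "u \<in> carrier A" "v \<in> carrier A" "u \<sqinter> v \<in> carrier A"
      "u \<sqinter> v \<sqinter> x \<in> carrier A" "u \<sqinter> x \<in> carrier A" "v \<sqinter> x \<in> carrier A"
      using uv filter_carrier[OF f] meet_closed x by blast+
    have "u \<sqinter> v \<sqinter> x \<sqsubseteq> u \<sqinter> x"
      by (rule meet_mono[OF car(3) x car(1) x meet_le1[OF car(1,2)] le_refl[OF x]])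
    then have 1: "u \<sqinter> v \<sqinter> x \<sqsubseteq> y"
      using le_trans[OF car(4,5) yz(1)] uv(3) by blast
    have "u \<sqinter> v \<sqinter> x \<sqsubseteq> v \<sqinter> x"
      by (rule meet_mono[OF car(3) x car(2) x meet_le2[OF car(1,2)] le_refl[OF x]])
    then have "u \<sqinter> v \<sqinter> x \<sqsubseteq> z"
      using le_trans[OF car(4,6) yz(2)] uv(4) by blast
    then have "u \<sqinter> v \<sqinter> x \<sqsubseteq> y \<sqinter> z"
      using meet_greatest[OF yz car(4) 1] by blast
    then show ?thesis using filter_meet[OF f uv(1,2)] meet_closed[OF yz] by blast
  qed
  moreover have "z \<in> ?g" if "y \<in> ?g" "z \<in> carrier A" "y \<sqsubseteq> z" for y z
  proof -
    from that obtain u where u: "u \<in> f" "u \<sqinter> x \<sqsubseteq> y" and y: "y \<in> carrier A" by blast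
    have "u \<sqinter> x \<sqsubseteq> z"
      using le_trans[OF meet_closed[OF filter_carrier[OF f u(1)] x] y] that(2,3) u(2) by blast
    then show ?thesis using u(1) that(2) by blast
  qed
  ultimately show "lattice_filter A ?g"
    unfolding lattice_filter_def using xg by blast
qed

end

section \<open>Ideals and the prime filter theorem\<close>

definition lattice_ideal :: "('a, 'm) heyting_scheme \<Rightarrow> 'a set \<Rightarrow> bool" where
  "lattice_ideal A I \<longleftrightarrow>
     I \<subseteq> carrier A \<and> I \<noteq> {} \<and>
     (\<forall>x\<in>I. \<forall>y\<in>I. x \<squnion>\<^bsub>A\<^esub> y \<in> I) \<and>
     (\<forall>x\<in>I. \<forall>y\<in>carrier A. y \<sqsubseteq>\<^bsub>A\<^esub> x \<longrightarrow> y \<in> I)"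

context heyting_algebra
begin

lemma principal_ideal:
  assumes a: "a \<in> carrier A"
  shows "lattice_ideal A {x \<in> carrier A. x \<sqsubseteq> a}" (is "lattice_ideal A ?I")
proof -
  have "a \<in> ?I" using a le_refl by blast
  moreover have "x \<squnion> y \<in> ?I" if "x \<in> ?I" "y \<in> ?I" for x y
    using that a join_least join_closed by simp
  moreover have "y \<in> ?I" if "x \<in> ?I" "y \<in> carrier A" "y \<sqsubseteq> x" for x y
    using that a le_trans[of y x a] by simp
  ultimately show ?thesis unfolding lattice_ideal_def by blast
qed

text \<open>By Zorn's lemma there is a filter maximal among those that contain \<open>g\<close> and
  miss \<open>I\<close>; maximality together with distributivity makes it prime.\<close>

theorem prime_filter_theorem:
  assumes g: "lattice_filter A g" and I: "lattice_ideal A I" and disj: "g \<inter> I = {}"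
  obtains f where "f \<in> prime_filters A" "g \<subseteq> f" "f \<inter> I = {}"
proof -
  let ?\<F> = "{f. lattice_filter A f \<and> g \<subseteq> f \<and> f \<inter> I = {}}"
  have "\<exists>f\<in>?\<F>. \<forall>h\<in>?\<F>. f \<subseteq> h \<longrightarrow> h = f"
  proof (rule subset_Zorn_nonempty)
    show "?\<F> \<noteq> {}" using g disj by blast
  next
    fix \<C> assume ne: "\<C> \<noteq> {}" and ch: "subset.chain ?\<F> \<C>"
    have sub: "\<C> \<subseteq> ?\<F>" and tot: "\<And>h k. \<lbrakk>h \<in> \<C>; k \<in> \<C>\<rbrakk> \<Longrightarrow> h \<subseteq> k \<or> k \<subseteq> h"
      using ch unfolding subset_chain_def by blast+
    have fil: "\<And>h. h \<in> \<C> \<Longrightarrow> lattice_filter A h" using sub by blast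
    have "x \<sqinter> y \<in> \<Union>\<C>" if xy: "x \<in> \<Union>\<C>" "y \<in> \<Union>\<C>" for x y
    proof -
      \<comment> \<open>The larger of two members of the chain contains both elements, so it
        contains their meet.\<close>
      obtain h k where "h \<in> \<C>" "k \<in> \<C>" "x \<in> h" "y \<in> k" using xy by blast
      then obtain l where "l \<in> \<C>" "x \<in> l" "y \<in> l" using tot by blast
      then show ?thesis using fil filter_meet by blast
    qed
    moreover have "\<Union>\<C> \<noteq> {}" using ne fil filter_top by blast
    moreover have "\<Union>\<C> \<subseteq> carrier A" using fil filter_carrier by blast
    moreover have "\<forall>x\<in>\<Union>\<C>. \<forall>y\<in>carrier A. x \<sqsubseteq> y \<longrightarrow> y \<in> \<Union>\<C>" using fil filter_up by blast
    ultimately have "lattice_filter A (\<Union>\<C>)" unfolding lattice_filter_def by blast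
    then show "\<Union>\<C> \<in> ?\<F>" using sub ne by blast
  qed
  then obtain f where F: "f \<in> ?\<F>" and max: "\<forall>h\<in>?\<F>. f \<subseteq> h \<longrightarrow> h = f" ..
  from F have f: "lattice_filter A f" "g \<subseteq> f" "f \<inter> I = {}" by simp_all
  \<comment> \<open>By maximality, adjoining \<open>x\<close> to \<open>f\<close> produces a filter
    that meets \<open>I\<close>. An element of the intersection lies above some
    \<open>u \<sqinter> x\<close>, which then belongs to \<open>I\<close> as well.\<close>
  have meets: "\<exists>u\<in>f. u \<sqinter> x \<in> I" if x: "x \<in> carrier A" "x \<notin> f" for x
  proof -
    let ?h = "{z \<in> carrier A. \<exists>u\<in>f. u \<sqinter> x \<sqsubseteq> z}"
    have h: "lattice_filter A ?h" "f \<subseteq> ?h" "x \<in> ?h"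
      using filter_adjoin[OF f(1) x(1)] by blast+
    have "?h \<inter> I \<noteq> {}"
    proof
      assume "?h \<inter> I = {}"
      then have "?h \<in> ?\<F>" using h f(2) by simp
      then have "?h = f" using max h(2) by blast
      then show False using h(3) x(2) by blast
    qed
    then obtain z u where "z \<in> I" "u \<in> f" "u \<sqinter> x \<sqsubseteq> z" by blast
    moreover have "u \<sqinter> x \<in> carrier A"
      using \<open>u \<in> f\<close> filter_carrier[OF f(1)] meet_closed x by blast
    ultimately show ?thesis using I unfolding lattice_ideal_def by blast
  qed
  have "x \<in> f \<or> y \<in> f"
    if xy: "x \<in> carrier A" "y \<in> carrier A" "x \<squnion> y \<in> f" for x y
  proof (rule ccontr)
    assume "\<not> ?thesis"
    then obtain u v where uv: "u \<in> f" "v \<in> f" "u \<sqinter> x \<in> I" "v \<sqinter> y \<in> I"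
      using meets xy by blast
    \<comment> \<open>A common witness for \<open>x\<close> and \<open>y\<close>: both
      \<open>?w \<sqinter> x\<close> and \<open>?w \<sqinter> y\<close> lie below \<open>?j\<close>,
      so distributivity forces \<open>?j\<close> into \<open>f\<close>, although it is a join of two
      elements of \<open>I\<close>.\<close>
    let ?w = "u \<sqinter> v" and ?j = "(u \<sqinter> x) \<squnion> (v \<sqinter> y)"
    have car: "u \<in> carrier A" "v \<in> carrier A" "?w \<in> carrier A" "u \<sqinter> x \<in> carrier A"
      "v \<sqinter> y \<in> carrier A" "?w \<sqinter> x \<in> carrier A" "?w \<sqinter> y \<in> carrier A" "?j \<in> carrier A"
      using uv(1,2)[THEN filter_carrier[OF f(1)]] xy(1,2) by (simp_all add: meet_closed join_closed)
    have "?w \<sqinter> x \<sqsubseteq> u \<sqinter> x"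
      by (rule meet_mono[OF car(3) xy(1) car(1) xy(1) meet_le1[OF car(1,2)] le_refl[OF xy(1)]])
    then have "?w \<sqinter> x \<sqsubseteq> ?j"
      using le_trans[OF car(6,4,8)] join_ge1[OF car(4,5)] by blast
    moreover have "?w \<sqinter> y \<sqsubseteq> v \<sqinter> y"
      by (rule meet_mono[OF car(3) xy(2) car(2) xy(2) meet_le2[OF car(1,2)] le_refl[OF xy(2)]])
    then have "?w \<sqinter> y \<sqsubseteq> ?j"
      using le_trans[OF car(7,5,8)] join_ge2[OF car(4,5)] by blast
    ultimately have "?w \<sqinter> (x \<squnion> y) \<sqsubseteq> ?j"
      using meet_join_le[OF car(3) xy(1,2) car(8)] by blast
    moreover have "?w \<sqinter> (x \<squnion> y) \<in> f" by (intro filter_meet[OF f(1)] uv xy)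
    ultimately have "?j \<in> f" using filter_up[OF f(1)] car(8) by blast
    moreover have "?j \<in> I" using I uv unfolding lattice_ideal_def by blast
    ultimately show False using f(3) by blast
  qed
  moreover have "f \<noteq> carrier A" using f(3) I unfolding lattice_ideal_def by blast
  ultimately have "f \<in> prime_filters A" using f(1) unfolding prime_filters_def by blast
  then show ?thesis using that f by blast
qed

section \<open>The representation map: order, lattice operations and implication\<close>

lemma prime_filterD:
  assumes "f \<in> prime_filters A"
  shows "lattice_filter A f"
    and "\<And>x y. \<lbrakk>x \<in> carrier A; y \<in> carrier A; x \<squnion> y \<in> f\<rbrakk> \<Longrightarrow> x \<in> f \<or> y \<in> f"
  using assms unfolding prime_filters_def by blast+

text \<open>The case of the principal ideal below \<open>a\<close>: since \<open>g\<close> is upward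
  closed, missing \<open>a\<close> already means missing that whole ideal.\<close>

lemma prime_filter_avoiding:
  assumes g: "lattice_filter A g" and a: "a \<in> carrier A" "a \<notin> g"
  obtains f where "f \<in> prime_filters A" "g \<subseteq> f" "a \<notin> f"
proof -
  have "g \<inter> {x \<in> carrier A. x \<sqsubseteq> a} = {}" using filter_up[OF g] a by blast
  from prime_filter_theorem[OF g principal_ideal[OF a(1)] this]
  obtain f where "f \<in> prime_filters A" "g \<subseteq> f" "f \<inter> {x \<in> carrier A. x \<sqsubseteq> a} = {}" .
  then show ?thesis using that a(1) le_refl[OF a(1)] by blast
qed

text \<open>If \<open>a\<close> is not below \<open>b\<close>, the principal filter of
  \<open>a\<close> misses \<open>b\<close> and extends to a prime filter that still misses
  \<open>b\<close>. Injectivity follows by antisymmetry.\<close>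

lemma repr_map_le_iff:
  assumes "a \<in> carrier A" "b \<in> carrier A"
  shows "repr_map A a \<subseteq> repr_map A b \<longleftrightarrow> a \<sqsubseteq> b"
proof
  assume sub: "repr_map A a \<subseteq> repr_map A b"
  show "a \<sqsubseteq> b"
  proof (rule ccontr)
    assume "\<not> a \<sqsubseteq> b"
    then have "b \<notin> {x \<in> carrier A. a \<sqsubseteq> x}" by blast
    from prime_filter_avoiding[OF principal_filter[OF assms(1)] assms(2) this]
    obtain f where "f \<in> prime_filters A" "{x \<in> carrier A. a \<sqsubseteq> x} \<subseteq> f" "b \<notin> f" .
    then show False using sub assms(1) le_refl[OF assms(1)] unfolding repr_map_def by blast
  qed
next
  assume "a \<sqsubseteq> b"
  then show "repr_map A a \<subseteq> repr_map A b"
    using assms filter_up prime_filterD(1) unfolding repr_map_def by blast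
qed

lemma inj_repr_map: "inj_on (repr_map A) (carrier A)"
  by (rule inj_onI) (metis le_antisym repr_map_le_iff order_refl)

lemma repr_map_meet:
  assumes "x \<in> carrier A" "y \<in> carrier A"
  shows "repr_map A (x \<sqinter> y) = repr_map A x \<inter> repr_map A y"
  using assms filter_meet filter_up meet_le1 meet_le2 prime_filterD(1)
  unfolding repr_map_def by blast

text \<open>Primeness gives the inclusion from left to right, upward closure the converse.\<close>

lemma repr_map_join:
  assumes "x \<in> carrier A" "y \<in> carrier A"
  shows "repr_map A (x \<squnion> y) = repr_map A x \<union> repr_map A y"
proof -
  have "x \<squnion> y \<in> f \<longleftrightarrow> x \<in> f \<or> y \<in> f" if f: "f \<in> prime_filters A" for f
    using prime_filterD(2)[OF f assms] filter_up[OF prime_filterD(1)[OF f]]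
      join_ge1[OF assms] join_ge2[OF assms] join_closed[OF assms] by blast
  then show ?thesis unfolding repr_map_def by blast
qed

lemma repr_map_bot: "repr_map A \<bottom> = {}"
  using prime_filter_bot unfolding repr_map_def by blast

lemma repr_map_top: "repr_map A \<top> = prime_filters A"
  using filter_top prime_filterD(1) unfolding repr_map_def by blast

text \<open>The Kripke clause for intuitionistic implication, with inclusion of prime filters as
  accessibility. From left to right it is modus ponens inside \<open>g\<close>; conversely, a
  counterexample \<open>g\<close> is found by extending the filter generated by \<open>f\<close> and
  \<open>x\<close>.\<close>

lemma imp_mem_prime_filter_iff:
  assumes f: "f \<in> prime_filters A" and xy: "x \<in> carrier A" "y \<in> carrier A"
  shows "(x \<Rrightarrow> y) \<in> f \<longleftrightarrow> (\<forall>g\<in>prime_filters A. f \<subseteq> g \<and> x \<in> g \<longrightarrow> y \<in> g)"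
proof
  assume i: "(x \<Rrightarrow> y) \<in> f"
  have "(x \<Rrightarrow> y) \<sqinter> x \<sqsubseteq> y" using residuation imp_closed le_refl xy by blast
  then show "\<forall>g\<in>prime_filters A. f \<subseteq> g \<and> x \<in> g \<longrightarrow> y \<in> g"
    using i xy filter_meet filter_up prime_filterD(1) by blast
next
  assume all: "\<forall>g\<in>prime_filters A. f \<subseteq> g \<and> x \<in> g \<longrightarrow> y \<in> g"
  have fil: "lattice_filter A f" using f prime_filterD(1) by blast
  show "(x \<Rrightarrow> y) \<in> f"
  proof (rule ccontr)
    assume i: "(x \<Rrightarrow> y) \<notin> f"
    \<comment> \<open>If \<open>u \<sqinter> x\<close> were below \<open>y\<close> with
      \<open>u\<close> in \<open>f\<close>, residuation would put \<open>u\<close> below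
      \<open>x \<Rrightarrow> y\<close>, which would then lie in \<open>f\<close>.\<close>
    have "y \<notin> {z \<in> carrier A. \<exists>u\<in>f. u \<sqinter> x \<sqsubseteq> z}"
      using i xy filter_carrier[OF fil] filter_up[OF fil] residuation imp_closed by blast
    from prime_filter_avoiding[OF filter_adjoin(1)[OF fil xy(1)] xy(2) this]
    obtain g where "g \<in> prime_filters A" "{z \<in> carrier A. \<exists>u\<in>f. u \<sqinter> x \<sqsubseteq> z} \<subseteq> g" "y \<notin> g" .
    then show False using all filter_adjoin(2,3)[OF fil xy(1)] by blast
  qed
qed

text \<open>The order being reverse inclusion, the relational image collects the prime filters
  contained in some \<open>g\<close> with \<open>x\<close> in \<open>g\<close> and \<open>y\<close>
  not in \<open>g\<close>: exactly those failing the Kripke clause.\<close>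

lemma repr_map_imp:
  assumes "x \<in> carrier A" "y \<in> carrier A"
  shows "repr_map A (x \<Rrightarrow> y) =
    prime_filters A - prime_filter_order A `` (repr_map A x - repr_map A y)"
  using imp_mem_prime_filter_iff[OF _ assms]
  unfolding repr_map_def prime_filter_order_def by blast

section \<open>Finite filters are principal, and the representation map is onto\<close>

lemma finite_subset_filter_lower_bound:
  assumes f: "lattice_filter A f" and "finite B" "B \<subseteq> f"
  shows "\<exists>m\<in>f. \<forall>b\<in>B. m \<sqsubseteq> b"
  using assms(2,3)
proof (induction B)
  case empty
  then show ?case using filter_top[OF f] by blast
next
  case (insert b B)
  then obtain m where m: "m \<in> f" "\<forall>c\<in>B. m \<sqsubseteq> c" by blast
  have car: "m \<in> carrier A" "b \<in> carrier A" "B \<subseteq> carrier A"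
    using m(1) insert.prems filter_carrier[OF f] by blast+
  have "m \<sqinter> b \<sqsubseteq> c" if "c \<in> B" for c
    using le_trans[OF meet_closed[OF car(1,2)] car(1)] meet_le1[OF car(1,2)] m(2) car(3) that by blast
  then have "\<forall>c\<in>insert b B. m \<sqinter> b \<sqsubseteq> c"
    using meet_le2[OF car(1,2)] by blast
  then show ?case using filter_meet[OF f] m insert.prems by blast
qed

lemma finite_filter_least:
  assumes f: "lattice_filter A f" and fin: "finite f"
  obtains m where "m \<in> f" "f = {x \<in> carrier A. m \<sqsubseteq> x}"
proof -
  obtain m where m: "m \<in> f" "\<forall>b\<in>f. m \<sqsubseteq> b"
    using finite_subset_filter_lower_bound[OF f fin] by blast
  then have "f = {x \<in> carrier A. m \<sqsubseteq> x}"
    using filter_carrier[OF f] filter_up[OF f] by blast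
  then show ?thesis using that m by blast
qed

text \<open>When \<open>f\<close> is the principal filter of \<open>m\<close>, the prime filters
  containing \<open>f\<close> are those containing \<open>m\<close>. Joining these generators over
  \<open>S\<close> represents the union, with \<bottom> for the empty set.\<close>

lemma finite_up_closure_repr_map:
  assumes fin: "finite (carrier A)" and "finite S" "S \<subseteq> prime_filters A"
  shows "\<exists>a\<in>carrier A. repr_map A a = {g \<in> prime_filters A. \<exists>f\<in>S. f \<subseteq> g}"
  using assms(2,3)
proof (induction S)
  case empty
  then show ?case using repr_map_bot bot_closed by auto
next
  case (insert f S)
  then obtain a where a: "a \<in> carrier A"
    "repr_map A a = {g \<in> prime_filters A. \<exists>f\<in>S. f \<subseteq> g}" by blast
  have f: "lattice_filter A f" using insert.prems prime_filterD(1) by blast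
  have "finite f" using fin f finite_subset unfolding lattice_filter_def by blast
  from finite_filter_least[OF f this]
  obtain m where m: "m \<in> f" "f = {x \<in> carrier A. m \<sqsubseteq> x}" .
  have mc: "m \<in> carrier A" using m(1) filter_carrier[OF f] by blast
  have "repr_map A m = {g \<in> prime_filters A. f \<subseteq> g}"
    using m mc filter_up prime_filterD(1) unfolding repr_map_def by blast
  then have "repr_map A (m \<squnion> a) = {g \<in> prime_filters A. \<exists>f\<in>insert f S. f \<subseteq> g}"
    by (auto simp: repr_map_join[OF mc a(1)] a(2))
  then show ?case using join_closed[OF mc a(1)] by blast
qed

text \<open>Downward closed for reverse inclusion means closed under larger prime filters. Such an
  \<open>S\<close> is finite and equals its own closure under supersets, hence is in the
  image.\<close>

lemma bij_betw_repr_map: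
  assumes fin: "finite (carrier A)"
  shows "bij_betw (repr_map A) (carrier A)
    (carrier (downset_algebra (prime_filters A) (prime_filter_order A)))" (is "bij_betw _ _ ?D")
proof -
  have D: "?D = {S. S \<subseteq> prime_filters A \<and>
      (\<forall>f\<in>S. \<forall>g\<in>prime_filters A. f \<subseteq> g \<longrightarrow> g \<in> S)}"
    unfolding downset_algebra_def prime_filter_order_def by auto
  have "repr_map A ` carrier A \<subseteq> ?D"
    unfolding D repr_map_def by blast
  moreover have "S \<in> repr_map A ` carrier A" if S: "S \<in> ?D" for S
  proof -
    have sub: "S \<subseteq> prime_filters A" using S D by blast
    have "prime_filters A \<subseteq> Pow (carrier A)"
      using prime_filterD(1) filter_carrier by blast
    then have "finite S" using fin sub finite_subset finite_Pow_iff by metis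
    from finite_up_closure_repr_map[OF fin this sub]
    obtain a where "a \<in> carrier A" "repr_map A a = {g \<in> prime_filters A. \<exists>f\<in>S. f \<subseteq> g}"
      by blast
    moreover have "{g \<in> prime_filters A. \<exists>f\<in>S. f \<subseteq> g} = S" using S unfolding D by blast
    ultimately show ?thesis by blast
  qed
  ultimately show ?thesis using inj_repr_map unfolding bij_betw_def by blast
qed

end

section \<open>The modal operators\<close>

context godel_algebra_with_operators
begin

lemma box_mono:
  assumes "x \<in> carrier A" "y \<in> carrier A" "x \<sqsubseteq> y"
  shows "box A x \<sqsubseteq> box A y"
  using assms box_meet unfolding hle_def by metis

lemma dia_mono:
  assumes "x \<in> carrier A" "y \<in> carrier A" "x \<sqsubseteq> y"
  shows "dia A x \<sqsubseteq> dia A y"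
  using assms dia_join dia_closed le_iff_join by metis

lemma box_vimage_filter:
  assumes f: "lattice_filter A f"
  shows "lattice_filter A {x \<in> carrier A. box A x \<in> f}" (is "lattice_filter A ?g")
proof -
  have "\<top> \<in> ?g" using box_top filter_top[OF f] top_closed by simp
  moreover have "x \<sqinter> y \<in> ?g" if "x \<in> ?g" "y \<in> ?g" for x y
    using that box_meet filter_meet[OF f] meet_closed by simp
  moreover have "y \<in> ?g" if "x \<in> ?g" "y \<in> carrier A" "x \<sqsubseteq> y" for x y
    using that filter_up[OF f] box_mono box_closed by blast
  ultimately show ?thesis unfolding lattice_filter_def by blast
qed

text \<open>Closure under joins is where primeness of \<open>f\<close> enters:
  \<open>dia A (x \<squnion> y)\<close> is a join of two elements outside \<open>f\<close>.
  Properness of \<open>f\<close> supplies \<bottom>.\<close>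

lemma dia_vimage_compl_ideal:
  assumes f: "f \<in> prime_filters A"
  shows "lattice_ideal A {x \<in> carrier A. dia A x \<notin> f}" (is "lattice_ideal A ?I")
proof -
  have fil: "lattice_filter A f" using f prime_filterD(1) by blast
  have "\<bottom> \<in> ?I" using dia_bot prime_filter_bot[OF f] bot_closed by simp
  moreover have "x \<squnion> y \<in> ?I" if "x \<in> ?I" "y \<in> ?I" for x y
    using that dia_join join_closed prime_filterD(2)[OF f dia_closed dia_closed, of x y] by auto
  moreover have "y \<in> ?I" if "x \<in> ?I" "y \<in> carrier A" "y \<sqsubseteq> x" for x y
    using that filter_up[OF fil] dia_mono dia_closed by blast
  ultimately show ?thesis unfolding lattice_ideal_def by blast
qed

text \<open>If \<open>box A a\<close> is not in \<open>f\<close>, the filter of all \<open>x\<close>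
  with \<open>box A x\<close> in \<open>f\<close> misses \<open>a\<close>. A prime filter extending
  it and missing \<open>a\<close> is an \<open>R_box\<close> successor of \<open>f\<close> outside
  \<open>repr_map A a\<close>.\<close>

lemma repr_map_box:
  assumes a: "a \<in> carrier A"
  shows "repr_map A (box A a) = beta A (repr_map A a)"
proof
  show "repr_map A (box A a) \<subseteq> beta A (repr_map A a)"
    using a unfolding repr_map_def beta_def R_box_def by blast
next
  show "beta A (repr_map A a) \<subseteq> repr_map A (box A a)"
  proof
    fix f assume fb: "f \<in> beta A (repr_map A a)"
    then have f: "f \<in> prime_filters A" unfolding beta_def by blast
    have "box A a \<in> f"
    proof (rule ccontr)
      assume "box A a \<notin> f"
      then have "a \<notin> {x \<in> carrier A. box A x \<in> f}" by blast
      from prime_filter_avoiding[OF box_vimage_filter[OF prime_filterD(1)[OF f]] a this]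
      obtain z where "z \<in> prime_filters A" "{x \<in> carrier A. box A x \<in> f} \<subseteq> z" "a \<notin> z" .
      then show False using fb f unfolding beta_def R_box_def repr_map_def by blast
    qed
    then show "f \<in> repr_map A (box A a)" using f unfolding repr_map_def by blast
  qed
qed

lemma repr_map_dia:
  assumes a: "a \<in> carrier A"
  shows "repr_map A (dia A a) = delta A (repr_map A a)"
proof
  show "delta A (repr_map A a) \<subseteq> repr_map A (dia A a)"
    unfolding repr_map_def delta_def R_dia_def by blast
next
  show "repr_map A (dia A a) \<subseteq> delta A (repr_map A a)"
  proof
    fix f assume "f \<in> repr_map A (dia A a)"
    then have f: "f \<in> prime_filters A" and da: "dia A a \<in> f"
      unfolding repr_map_def by blast+
    \<comment> \<open>Any \<open>x\<close> above \<open>a\<close> has \<open>dia A x\<close> above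
      \<open>dia A a\<close>, hence in \<open>f\<close>. A prime filter separating the two sets
      contains \<open>a\<close> and is an \<open>R_dia\<close> successor of
      \<open>f\<close>.\<close>
    have "{x \<in> carrier A. a \<sqsubseteq> x} \<inter> {x \<in> carrier A. dia A x \<notin> f} = {}"
      using a da f filter_up dia_mono dia_closed prime_filterD(1) by blast
    from prime_filter_theorem[OF principal_filter[OF a] dia_vimage_compl_ideal[OF f] this]
    obtain z where z: "z \<in> prime_filters A" "{x \<in> carrier A. a \<sqsubseteq> x} \<subseteq> z"
      "z \<inter> {x \<in> carrier A. dia A x \<notin> f} = {}" .
    then have "z \<subseteq> {x \<in> carrier A. dia A x \<in> f}"
      using filter_carrier prime_filterD(1) by blast
    then show "f \<in> delta A (repr_map A a)"
      using z(1,2) f a le_refl[OF a] unfolding delta_def R_dia_def repr_map_def by blast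
  qed
qed

section \<open>The isomorphism and transport of the axioms\<close>

lemma gao_iso_repr_map:
  assumes "finite (carrier A)"
  shows "gao_iso (repr_map A) A (dual_gao A)"
  by (simp add: gao_iso_def dual_gao_simps bij_betw_repr_map[OF assms] repr_map_meet repr_map_join
      repr_map_imp repr_map_bot repr_map_top repr_map_box repr_map_dia)

text \<open>Every element of \<open>B\<close> is some \<open>h x\<close>, and \<open>h\<close>
  commutes with all operations, so each axiom of \<open>B\<close> is the image of the same axiom of
  \<open>A\<close>.\<close>

lemma gao_iso_transfer:
  assumes iso: "gao_iso h A B"
  shows "godel_algebra_with_operators B"
proof -
  have B: "carrier B = h ` carrier A" and inj: "inj_on h (carrier A)"
    using iso unfolding gao_iso_def bij_betw_def by auto
  have hom:
    "\<And>x y. \<lbrakk>x \<in> carrier A; y \<in> carrier A\<rbrakk> \<Longrightarrow> h x \<sqinter>\<^bsub>B\<^esub> h y = h (x \<sqinter> y)"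
    "\<And>x y. \<lbrakk>x \<in> carrier A; y \<in> carrier A\<rbrakk> \<Longrightarrow> h x \<squnion>\<^bsub>B\<^esub> h y = h (x \<squnion> y)"
    "\<And>x y. \<lbrakk>x \<in> carrier A; y \<in> carrier A\<rbrakk> \<Longrightarrow> (h x \<Rrightarrow>\<^bsub>B\<^esub> h y) = h (x \<Rrightarrow> y)"
    "\<bottom>\<^bsub>B\<^esub> = h \<bottom>" "\<top>\<^bsub>B\<^esub> = h \<top>"
    "\<And>x. x \<in> carrier A \<Longrightarrow> box B (h x) = h (box A x)"
    "\<And>x. x \<in> carrier A \<Longrightarrow> dia B (h x) = h (dia A x)"
    using iso unfolding gao_iso_def by simp_all
  note closed = meet_closed join_closed imp_closed bot_closed top_closed box_closed dia_closed
  \<comment> \<open>The order is an equation between meets, so injectivity of \<open>h\<close>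
    reflects it; this carries over the bounds and residuation.\<close>
  have le: "h x \<sqsubseteq>\<^bsub>B\<^esub> h y \<longleftrightarrow> x \<sqsubseteq> y" if "x \<in> carrier A" "y \<in> carrier A" for x y
    using that inj_on_eq_iff[OF inj] by (simp add: hle_def hom closed)
  show ?thesis
    by unfold_locales
      (auto simp: B hom closed le residuation meet_assoc join_assoc meet_join_absorb join_meet_absorb
        bot_least top_greatest prelinearity box_top box_meet dia_bot dia_join
        intro: arg_cong[OF meet_comm] arg_cong[OF join_comm])
qed

end

theorem theorem3p6:
  fixes A :: "'a gao"
  assumes "godel_algebra_with_operators A"
    and "finite (carrier A)"
  shows "godel_algebra_with_operators (dual_gao A)
    \<and> gao_iso (repr_map A) A (dual_gao A)
    \<and> (\<forall>a\<in>carrier A. repr_map A (box A a) = beta A (repr_map A a)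
                     \<and> repr_map A (dia A a) = delta A (repr_map A a))"
proof -
  interpret godel_algebra_with_operators A by (rule assms(1))
  show ?thesis
    using gao_iso_transfer gao_iso_repr_map[OF assms(2)] repr_map_box repr_map_dia by blast
qed

end
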